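(* In the screening model described in the context, suppose that (1) (limited feasible recourse) $\bar r<a_L/\delta$ and $K_L(\bar r)<v$; and (2) (acceptance dominance at the top) $q_H(r)(a_H+\delta r)\le a_H$ for every $r\in\mathcal R$. Let $p^A=\frac{a_L}{a_H+a_L}$. Then there exist cutoffs $$0<\underline p<p^A<\bar p\le 1$$ such that the tie-broken optimal decision rule is $$\varphi^*(p)=\begin{cases}R,&p\in[0,\underline p),\\ (O,r^*(p)),&p\in[\underline p,\bar p),\\ A,&p\in[\bar p,1],\end{cases}$$ where $r^*(p)\in\arg\max_{r\in\mathcal R}U^O(p,r)$ at every $p\in[\underline p,\bar p)$.
   Context: Primitives: real numbers $a_H>0$, $a_L>0$, $v>0$, $\delta>0$, $\bar\varepsilon>0$; a compact interval $\mathcal R=[\underline r,\bar r]$ with $0<\underline r\le\bar r$; for each type $\theta\in\{H,L\}$ a twice differentiable function $K_\theta:\mathcal R\to\mathbb R$ with $K_\theta\ge 0$, $K_\theta'>0$, $K_\theta''\ge 0$ on $\mathcal R$ (derivatives one-sided at endpoints), and $K_H(r)\le K_L(r)$ for all $r\in\mathcal R$. Completion probabilities (the probability that $K_\theta(r)+\varepsilon\le v$ when $\varepsilon$ is uniform on $[0,\bar\varepsilon]$): $$q_\theta(r)=\min\left\{\max\left\{\frac{v-K_\theta(r)}{\bar\varepsilon},0\right\},1\right\}.$$ At posterior belief $p\in[0,1]$ (the probability that the applicant is of type $H$), the principal chooses one of: accept ($A$), reject ($R$), or offer recourse with some requirement $r\in\mathcal R$ ($(O,r)$). The payoffs are $$U^A(p)=pa_H-(1-p)a_L,\qquad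 U^R=0,\qquad U^O(p,r)=p\,q_H(r)(a_H+\delta r)+(1-p)\,q_L(r)(-a_L+\delta r).$$ Let $V^O(p)=\max_{r\in\mathcal R}U^O(p,r)$. Tie-broken optimal action at $p$: the principal picks an action with the largest payoff, and if two actions give the same payoff, chooses accept over recourse, accept over reject, and recourse over reject. That is: accept if $U^A(p)\ge\max\{0,V^O(p)\}$; otherwise offer recourse (with a requirement attaining $V^O(p)$) if $V^O(p)\ge 0$; otherwise reject. The tie-broken optimal decision rule assigns to each $p\in[0,1]$ its tie-broken optimal action. *)

theory Defs
  imports Complex_Main
begin

datatype applicant = H | L

datatype decision = Accept | Reject | Offer real

record screening =
  a_H :: real
  a_L :: real
  v :: real
  \<delta> :: real
  eps_max :: real
  r_min :: real
  r_max :: real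
  K :: "applicant \<Rightarrow> real \<Rightarrow> real"

definition requirements :: "screening \<Rightarrow> real set" where
  "requirements M = {r_min M..r_max M}"

text \<open>Derivatives are taken within the interval, hence one-sided at its endpoints. If the
  interval is a single point, every number is such a derivative, so the derivative conditions
  hold vacuously.\<close>

definition screening_model :: "screening \<Rightarrow> bool" where
  "screening_model M \<longleftrightarrow>
     0 < a_H M \<and> 0 < a_L M \<and> 0 < v M \<and> 0 < \<delta> M \<and> 0 < eps_max M \<and>
     0 < r_min M \<and> r_min M \<le> r_max M \<and>
     (\<forall>\<theta>. \<exists>K' K''. \<forall>r\<in>requirements M.
        (K M \<theta> has_real_derivative K' r) (at r within requirements M) \<and>
        (K' has_real_derivative K'' r) (at r within requirements M) \<and>
        0 \<le> K M \<theta> r \<and> 0 < K' r \<and> 0 \<le> K'' r) \<and>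
     (\<forall>r\<in>requirements M. K M H r \<le> K M L r)"

definition q :: "screening \<Rightarrow> applicant \<Rightarrow> real \<Rightarrow> real" where
  "q M \<theta> r = min (max ((v M - K M \<theta> r) / eps_max M) 0) 1"

definition U_A :: "screening \<Rightarrow> real \<Rightarrow> real" where
  "U_A M p = p * a_H M - (1 - p) * a_L M"

definition U_O :: "screening \<Rightarrow> real \<Rightarrow> real \<Rightarrow> real" where
  "U_O M p r = p * q M H r * (a_H M + \<delta> M * r) + (1 - p) * q M L r * (- a_L M + \<delta> M * r)"

definition V_O :: "screening \<Rightarrow> real \<Rightarrow> real" where
  "V_O M p = (GREATEST u. u \<in> U_O M p ` requirements M)"

text \<open>A relation rather than a function of the belief, since several requirements may attain
  the maximum. The constant \<open>0\<close> is the payoff of rejecting.\<close>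

definition tie_broken_optimal :: "screening \<Rightarrow> real \<Rightarrow> decision \<Rightarrow> bool" where
  "tie_broken_optimal M p d \<longleftrightarrow>
     (if U_A M p \<ge> max 0 (V_O M p) then d = Accept
      else if V_O M p \<ge> 0 then \<exists>r\<in>requirements M. U_O M p r = V_O M p \<and> d = Offer r
      else d = Reject)"

definition tie_broken_optimal_rule :: "screening \<Rightarrow> (real \<Rightarrow> decision) \<Rightarrow> bool" where
  "tie_broken_optimal_rule M \<phi> \<longleftrightarrow> (\<forall>p\<in>{0..1}. tie_broken_optimal M p (\<phi> p))"

definition p_A :: "screening \<Rightarrow> real" where
  "p_A M = a_L M / (a_H M + a_L M)"

end

theory Submission
  imports Defs
begin

text \<open>Write \<open>U_O M p r = p A(r) - (1 - p) B(r)\<close> with \<open>A\<close>, \<open>B\<close> the payoffs below. Limited feasible recourse makes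
  both positive, so for a fixed requirement \<open>r\<close> recourse beats rejection exactly from the belief
  \<open>B / (A + B)\<close> on; acceptance dominance gives \<open>A \<le> a_H\<close>, and \<open>B < a_L\<close> since \<open>r > 0\<close>, so acceptance
  beats recourse exactly from \<open>(a_L - B) / ((a_H - A) + (a_L - B))\<close> on. Both thresholds are
  continuous in \<open>r\<close>; the lower cutoff is the minimum of the first and the upper cutoff the maximum of
  the second. At \<open>p_A\<close>, where acceptance pays \<open>0\<close>, every requirement pays strictly more than \<open>0\<close>
  because \<open>q_H \<ge> q_L > 0\<close>; this puts \<open>p_A\<close> strictly between the cutoffs.\<close>

section \<open>Recourse payoff as gain minus loss; thresholds and maxima\<close>

definition gain_H :: "screening \<Rightarrow> real \<Rightarrow> real" where
  "gain_H M r = q M H r * (a_H M + \<delta> M * r)"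

definition loss_L :: "screening \<Rightarrow> real \<Rightarrow> real" where
  "loss_L M r = q M L r * (a_L M - \<delta> M * r)"

lemma U_O_gain_loss: "U_O M p r = p * gain_H M r - (1 - p) * loss_L M r"
  by (simp add: U_O_def gain_H_def loss_L_def algebra_simps)

lemma U_A_p_A:
  assumes "0 < a_H M" "0 < a_L M"
  shows "U_A M (p_A M) = 0"
  using assms by (simp add: U_A_def p_A_def field_simps add_pos_pos less_imp_neq)

text \<open>Every pairwise comparison of actions takes this form. Only the sum must be positive, so
  \<open>a = 0\<close> is allowed, as happens when acceptance dominance is an equality.\<close>

lemma affine_nonneg_iff_threshold:
  fixes a b p :: real
  assumes "0 < a + b"
  shows "(1 - p) * b \<le> p * a \<longleftrightarrow> b / (a + b) \<le> p"
  using assms by (simp add: pos_divide_le_eq algebra_simps)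

lemma compact_requirements: "compact (requirements M)"
  by (simp add: requirements_def)

text \<open>A \<open>GREATEST\<close> term is informative only once a greatest element is known; the
  extreme value theorem supplies one.\<close>

lemma V_O_is_max:
  assumes "requirements M \<noteq> {}" "continuous_on (requirements M) (U_O M p)"
  shows "\<exists>r\<in>requirements M. U_O M p r = V_O M p"
    and "r \<in> requirements M \<Longrightarrow> U_O M p r \<le> V_O M p"
proof -
  obtain s where s: "s \<in> requirements M" "\<forall>r\<in>requirements M. U_O M p r \<le> U_O M p s"
    using continuous_attains_sup[OF compact_requirements assms] by blast
  have "V_O M p = U_O M p s"
    unfolding V_O_def by (rule Greatest_equality) (use s in auto)
  then show "\<exists>r\<in>requirements M. U_O M p r = V_O M p"
    and "r \<in> requirements M \<Longrightarrow> U_O M p r \<le> V_O M p"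
    using s by auto
qed

lemma tie_broken_optimal_exists:
  assumes "\<exists>r\<in>requirements M. U_O M p r = V_O M p"
  shows "\<exists>d. tie_broken_optimal M p d"
  using assms unfolding tie_broken_optimal_def by auto

section \<open>Regularity and monotonicity of costs and completion probabilities\<close>

context
  fixes M :: screening
  assumes model: "screening_model M"
begin

lemma parameters_pos: "0 < a_H M" "0 < a_L M" "0 < \<delta> M" "0 < eps_max M"
  using model by (auto simp: screening_model_def)

lemma requirements_nonempty: "requirements M \<noteq> {}"
  using model by (auto simp: screening_model_def requirements_def)

lemma requirement_pos: "r \<in> requirements M \<Longrightarrow> 0 < r"
  using model by (auto simp: screening_model_def requirements_def)

lemma K_derivative:
  "\<exists>K'. \<forall>r\<in>requirements M.
    (K M \<theta> has_real_derivative K' r) (at r within requirements M) \<and> 0 < K' r"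
proof -
  have "\<exists>K' K''. \<forall>r\<in>requirements M.
      (K M \<theta> has_real_derivative K' r) (at r within requirements M) \<and>
      (K' has_real_derivative K'' r) (at r within requirements M) \<and>
      0 \<le> K M \<theta> r \<and> 0 < K' r \<and> 0 \<le> K'' r"
    using model unfolding screening_model_def by simp
  then show ?thesis by blast
qed

lemma continuous_on_K: "continuous_on (requirements M) (K M \<theta>)"
proof -
  obtain K' where "\<forall>r\<in>requirements M.
      (K M \<theta> has_real_derivative K' r) (at r within requirements M) \<and> 0 < K' r"
    using K_derivative[of \<theta>] by auto
  then show ?thesis
    unfolding continuous_on_eq_continuous_within by (auto intro: DERIV_continuous)
qed

text \<open>The positive derivative is needed only at interior points, where the one within the
  interval is the ordinary one. This carries the bound \<open>K M L (r_max M) < v M\<close> to all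
  requirements.\<close>

lemma K_le_at_r_max:
  assumes r: "r \<in> requirements M"
  shows "K M \<theta> r \<le> K M \<theta> (r_max M)"
proof (cases "r < r_max M")
  case True
  obtain K' where K': "\<forall>s\<in>requirements M.
      (K M \<theta> has_real_derivative K' s) (at s within requirements M) \<and> 0 < K' s"
    using K_derivative[of \<theta>] by auto
  have "K M \<theta> r < K M \<theta> (r_max M)"
  proof (rule DERIV_pos_imp_increasing_open[OF True])
    fix s assume s: "r < s" "s < r_max M"
    then have "s \<in> requirements M" "at s within requirements M = at s"
      using r by (auto simp: requirements_def intro: at_within_Icc_at)
    then show "\<exists>y. DERIV (K M \<theta>) s :> y \<and> 0 < y"
      using K' by metis
  next
    show "continuous_on {r..r_max M} (K M \<theta>)"
      using continuous_on_K r by (rule_tac continuous_on_subset) (auto simp: requirements_def)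
  qed
  then show ?thesis by simp
qed (use r in \<open>auto simp: requirements_def\<close>)

lemma continuous_on_q: "continuous_on (requirements M) (q M \<theta>)"
  unfolding q_def using parameters_pos
  by (intro continuous_intros continuous_on_K) auto

lemma continuous_on_gain_H: "continuous_on (requirements M) (gain_H M)"
  unfolding gain_H_def by (intro continuous_intros continuous_on_q)

lemma continuous_on_loss_L: "continuous_on (requirements M) (loss_L M)"
  unfolding loss_L_def by (intro continuous_intros continuous_on_q)

lemma continuous_on_U_O: "continuous_on (requirements M) (U_O M p)"
  unfolding U_O_gain_loss[abs_def]
  by (intro continuous_intros continuous_on_gain_H continuous_on_loss_L)

lemma q_L_le_q_H:
  assumes "r \<in> requirements M"
  shows "q M L r \<le> q M H r"
proof -
  have "K M H r \<le> K M L r" using model assms by (auto simp: screening_model_def)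
  then have "(v M - K M L r) / eps_max M \<le> (v M - K M H r) / eps_max M"
    using parameters_pos by (simp add: divide_right_mono)
  then show ?thesis by (auto simp: q_def)
qed

lemma U_A_nonneg_iff: "0 \<le> U_A M p \<longleftrightarrow> p_A M \<le> p"
  using affine_nonneg_iff_threshold[of "a_H M" "a_L M" p] parameters_pos
  by (simp add: U_A_def p_A_def)

section \<open>Signs and bounds under limited feasible recourse\<close>

context
  assumes feasible: "r_max M < a_L M / \<delta> M" "K M L (r_max M) < v M"
begin

lemma q_L_pos:
  assumes "r \<in> requirements M"
  shows "0 < q M L r"
  using K_le_at_r_max[OF assms, of L] feasible parameters_pos by (simp add: q_def)

lemma delta_mult_less:
  assumes "r \<in> requirements M"
  shows "\<delta> M * r < a_L M"
proof -
  have "r < a_L M / \<delta> M" using assms feasible by (auto simp: requirements_def)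
  then show ?thesis using parameters_pos by (simp add: field_simps)
qed

lemma loss_L_pos:
  assumes "r \<in> requirements M"
  shows "0 < loss_L M r"
  using q_L_pos[OF assms] delta_mult_less[OF assms] by (simp add: loss_L_def)

lemma gain_H_pos:
  assumes "r \<in> requirements M"
  shows "0 < gain_H M r"
  using q_L_pos[OF assms] q_L_le_q_H[OF assms] requirement_pos[OF assms] parameters_pos
  by (simp add: gain_H_def add_pos_pos)

lemma loss_L_less_a_L:
  assumes "r \<in> requirements M"
  shows "loss_L M r < a_L M"
proof -
  have "loss_L M r \<le> 1 * (a_L M - \<delta> M * r)"
    unfolding loss_L_def
    by (rule mult_right_mono) (use delta_mult_less[OF assms] in \<open>auto simp: q_def\<close>)
  also have "\<dots> < a_L M"
    using requirement_pos[OF assms] parameters_pos by simp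
  finally show ?thesis .
qed

text \<open>The odds at \<open>p_A\<close> are \<open>a_L\<close> to \<open>a_H\<close>, so the sign
  is that of \<open>a_L * gain_H - a_H * loss_L\<close>. The part without \<delta> is
  \<open>a_H * a_L * (q_H - q_L)\<close>, which is nonnegative; the part with \<delta> is strictly
  positive.\<close>

lemma U_O_p_A_pos:
  assumes "r \<in> requirements M"
  shows "0 < U_O M (p_A M) r"
proof -
  have "a_H M * loss_L M r < a_H M * (q M L r * a_L M)"
    using q_L_pos[OF assms] requirement_pos[OF assms] parameters_pos by (simp add: loss_L_def)
  also have "\<dots> = a_L M * (q M L r * a_H M)" by simp
  also have "\<dots> \<le> a_L M * gain_H M r"
    unfolding gain_H_def using q_L_pos[OF assms] q_L_le_q_H[OF assms]
      requirement_pos[OF assms] parameters_pos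
    by (intro mult_left_mono mult_mono) auto
  finally have "0 < (a_L M * gain_H M r - a_H M * loss_L M r) / (a_H M + a_L M)"
    using parameters_pos by simp
  also have "\<dots> = U_O M (p_A M) r"
  proof -
    have "1 - p_A M = a_H M / (a_H M + a_L M)"
      using parameters_pos by (simp add: p_A_def field_simps)
    then show ?thesis by (simp add: U_O_gain_loss p_A_def diff_divide_distrib)
  qed
  finally show ?thesis .
qed

section \<open>Existence of the two cutoffs\<close>

lemma lower_cutoff:
  obtains p_lo where "0 < p_lo" "p_lo < p_A M" "\<And>p. 0 \<le> V_O M p \<longleftrightarrow> p_lo \<le> p"
proof -
  define t where "t = (\<lambda>r. loss_L M r / (gain_H M r + loss_L M r))"
  have pos: "0 < gain_H M r + loss_L M r" if "r \<in> requirements M" for r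
    using gain_H_pos[OF that] loss_L_pos[OF that] by simp
  have t: "0 \<le> U_O M p r \<longleftrightarrow> t r \<le> p" if "r \<in> requirements M" for p r
    using affine_nonneg_iff_threshold[OF pos[OF that], of p] by (simp add: U_O_gain_loss t_def)
  have "continuous_on (requirements M) t"
    unfolding t_def using pos
    by (intro continuous_intros continuous_on_gain_H continuous_on_loss_L) force
  \<comment> \<open>Offering recourse is worthwhile as soon as one requirement reaches its
    threshold, hence the minimum.\<close>
  then obtain s where s: "s \<in> requirements M" "\<forall>r\<in>requirements M. t s \<le> t r"
    using continuous_attains_inf[OF compact_requirements requirements_nonempty] by blast
  show thesis
  proof
    show "0 < t s" using loss_L_pos[OF s(1)] pos[OF s(1)] by (simp add: t_def)
    \<comment> \<open>This excludes \<open>t s = p_A M\<close>, where the payoff is strictly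
      positive; the equivalence \<open>t\<close> alone gives only \<le>.\<close>
    have "U_O M (t s) s = 0"
      using pos[OF s(1)] unfolding U_O_gain_loss t_def
      by (simp add: divide_simps less_imp_neq)
    then show "t s < p_A M"
      using t[OF s(1), of "p_A M"] U_O_p_A_pos[OF s(1)] by (cases "t s = p_A M") auto
    note V_O = V_O_is_max[OF requirements_nonempty continuous_on_U_O]
    show "0 \<le> V_O M p \<longleftrightarrow> t s \<le> p" for p
    proof
      assume "0 \<le> V_O M p"
      then obtain r where r: "r \<in> requirements M" "0 \<le> U_O M p r"
        using V_O(1)[of p] by auto
      then have "t r \<le> p" using t by simp
      with r s show "t s \<le> p" by force
    next
      assume "t s \<le> p"
      then have "0 \<le> U_O M p s" using t[OF s(1)] by simp
      also have "\<dots> \<le> V_O M p" by (rule V_O(2)[OF s(1)])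
      finally show "0 \<le> V_O M p" .
    qed
  qed
qed

lemma upper_cutoff:
  assumes dominance: "\<And>r. r \<in> requirements M \<Longrightarrow> gain_H M r \<le> a_H M"
  obtains p_hi where "p_A M < p_hi" "p_hi \<le> 1" "\<And>p. V_O M p \<le> U_A M p \<longleftrightarrow> p_hi \<le> p"
proof -
  define t where
    "t = (\<lambda>r. (a_L M - loss_L M r) / ((a_H M - gain_H M r) + (a_L M - loss_L M r)))"
  \<comment> \<open>Dominance makes the first summand only nonnegative; strictness comes from the
    second.\<close>
  have pos: "0 < (a_H M - gain_H M r) + (a_L M - loss_L M r)" if "r \<in> requirements M" for r
    using dominance[OF that] loss_L_less_a_L[OF that] by simp
  have t: "U_O M p r \<le> U_A M p \<longleftrightarrow> t r \<le> p" if "r \<in> requirements M" for p r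
    using affine_nonneg_iff_threshold[OF pos[OF that], of p]
    by (simp add: U_O_gain_loss U_A_def t_def algebra_simps)
  have "continuous_on (requirements M) t"
    unfolding t_def using pos
    by (intro continuous_intros continuous_on_gain_H continuous_on_loss_L) force
  \<comment> \<open>Acceptance has to match every requirement, hence the maximum.\<close>
  then obtain s where s: "s \<in> requirements M" "\<forall>r\<in>requirements M. t r \<le> t s"
    using continuous_attains_sup[OF compact_requirements requirements_nonempty] by blast
  show thesis
  proof
    show "p_A M < t s"
      using t[OF s(1), of "p_A M"] U_O_p_A_pos[OF s(1)] U_A_p_A[of M] parameters_pos by simp
    \<comment> \<open>At belief \<open>1\<close> only the high type counts, and the comparison is
      dominance itself.\<close>
    show "t s \<le> 1"
      using t[OF s(1), of 1] dominance[OF s(1)] by (simp add: U_O_gain_loss U_A_def)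
    note V_O = V_O_is_max[OF requirements_nonempty continuous_on_U_O]
    show "V_O M p \<le> U_A M p \<longleftrightarrow> t s \<le> p" for p
    proof
      assume "V_O M p \<le> U_A M p"
      then have "U_O M p s \<le> U_A M p" using V_O(2)[OF s(1)] by (rule order_trans[rotated])
      then show "t s \<le> p" using t[OF s(1)] by simp
    next
      assume ts: "t s \<le> p"
      obtain r where r: "r \<in> requirements M" "U_O M p r = V_O M p"
        using V_O(1)[of p] by blast
      then have "t r \<le> p" using s ts by force
      then show "V_O M p \<le> U_A M p" using t[OF r(1), of p] r(2) by simp
    qed
  qed
qed

end

end

text \<open>Maximisers need not be unique, so the claim covers every optimal rule and lets
  \<open>r_opt\<close> depend on it; the separate existence claim prevents vacuity.\<close>

theorem proposition2:
  fixes M :: screening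
  assumes "screening_model M"
    and "r_max M < a_L M / \<delta> M"
    and "K M L (r_max M) < v M"
    and "\<forall>r\<in>requirements M. q M H r * (a_H M + \<delta> M * r) \<le> a_H M"
  shows "\<exists>p_lo p_hi. 0 < p_lo \<and> p_lo < p_A M \<and> p_A M < p_hi \<and> p_hi \<le> 1 \<and>
    (\<exists>\<phi>. tie_broken_optimal_rule M \<phi>) \<and>
    (\<forall>\<phi>. tie_broken_optimal_rule M \<phi> \<longrightarrow>
      (\<exists>r_opt.
        (\<forall>p\<in>{p_lo..<p_hi}. is_arg_max (U_O M p) (\<lambda>r. r \<in> requirements M) (r_opt p)) \<and>
        (\<forall>p\<in>{0..<p_lo}. \<phi> p = Reject) \<and>
        (\<forall>p\<in>{p_lo..<p_hi}. \<phi> p = Offer (r_opt p)) \<and>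
        (\<forall>p\<in>{p_hi..1}. \<phi> p = Accept)))"
proof -
  have dominance: "gain_H M r \<le> a_H M" if "r \<in> requirements M" for r
    using assms(4) that by (simp add: gain_H_def)
  obtain p_lo where lo: "0 < p_lo" "p_lo < p_A M" "\<And>p. 0 \<le> V_O M p \<longleftrightarrow> p_lo \<le> p"
    using lower_cutoff[OF assms(1-3)] by blast
  obtain p_hi where hi: "p_A M < p_hi" "p_hi \<le> 1" "\<And>p. V_O M p \<le> U_A M p \<longleftrightarrow> p_hi \<le> p"
    using upper_cutoff[OF assms(1-3) dominance] by blast
  note V_O = V_O_is_max[OF requirements_nonempty[OF assms(1)] continuous_on_U_O[OF assms(1)]]
  \<comment> \<open>From \<open>p_hi\<close> on the belief exceeds \<open>p_A\<close>, so acceptance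
    that matches recourse also beats rejection.\<close>
  have accept: "max 0 (V_O M p) \<le> U_A M p \<longleftrightarrow> p_hi \<le> p" for p
    using U_A_nonneg_iff[OF assms(1), of p] hi by auto
  have "\<exists>\<phi>. tie_broken_optimal_rule M \<phi>"
    unfolding tie_broken_optimal_rule_def
    by (intro bchoice ballI tie_broken_optimal_exists V_O(1))
  moreover have "\<exists>r_opt.
        (\<forall>p\<in>{p_lo..<p_hi}. is_arg_max (U_O M p) (\<lambda>r. r \<in> requirements M) (r_opt p)) \<and>
        (\<forall>p\<in>{0..<p_lo}. \<phi> p = Reject) \<and>
        (\<forall>p\<in>{p_lo..<p_hi}. \<phi> p = Offer (r_opt p)) \<and>
        (\<forall>p\<in>{p_hi..1}. \<phi> p = Accept)"
    if rule: "tie_broken_optimal_rule M \<phi>" for \<phi>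
  proof -
    have opt: "if p_hi \<le> p then \<phi> p = Accept
      else if p_lo \<le> p then \<exists>r\<in>requirements M. U_O M p r = V_O M p \<and> \<phi> p = Offer r
      else \<phi> p = Reject" if "p \<in> {0..1}" for p
      using rule that by (simp add: tie_broken_optimal_rule_def tie_broken_optimal_def accept lo(3)
          del: max.bounded_iff)
    have "\<exists>r. is_arg_max (U_O M p) (\<lambda>r. r \<in> requirements M) r \<and> \<phi> p = Offer r"
      if "p \<in> {p_lo..<p_hi}" for p
    proof -
      have "p \<in> {0..1}" "p_lo \<le> p" "\<not> p_hi \<le> p" using that lo hi by auto
      then obtain r where "r \<in> requirements M" "U_O M p r = V_O M p" "\<phi> p = Offer r"
        using opt[of p] by auto
      then show ?thesis using V_O(2) by (auto simp: is_arg_max_def not_less)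
    qed
    then obtain r_opt where "\<forall>p\<in>{p_lo..<p_hi}.
        is_arg_max (U_O M p) (\<lambda>r. r \<in> requirements M) (r_opt p) \<and> \<phi> p = Offer (r_opt p)"
      by metis
    moreover have "\<phi> p = Reject" if "p \<in> {0..<p_lo}" for p
      using opt[of p] that lo hi by auto
    moreover have "\<phi> p = Accept" if "p \<in> {p_hi..1}" for p
      using opt[of p] that lo hi by auto
    ultimately show ?thesis by blast
  qed
  ultimately show ?thesis using lo(1,2) hi(1,2) by blast
qed

end
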